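(* Let $X$ be a Fréchet sequence space, endowed with the compatible metric $d$. Suppose that the sequence $(e_n)_{n\in\mathbb{N}}$ of canonical vectors is a basis. Suppose that the unilateral weighted backward shift $B_w$, with nonzero weights $w:=(w_n)_{n\in\mathbb{N}}$, is well-defined and continuous on $X$. Then $B_w$ is mean Li--Yorke chaotic if and only if the following condition holds: There exist $\varepsilon>0$ and an increasing sequence $(N_k)_{k\in\mathbb{N}}$ of positive integers such that for each $k\in\mathbb{N}$ there are $r:=r(k)\in\mathbb{N}$ and scalars $b_{1,k},\dots,b_{r,k}\in\mathbb{K}$ with $d\left(\sum_{j=1}^{r}b_{j,k}e_j,0\right)<\frac1k$ and $$\frac{1}{N_k}\sum_{i=1}^{N_k}d\left(\sum_{j=1}^{r}b_{j,k}w_{j-i}\cdots w_{j-1}e_{j-i},0\right)\ge\varepsilon,$$ where we put $e_k=(0)_{j\in\mathbb{N}}$ (the zero sequence) and $w_k=0$ for $k<1$.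
   Context: $\mathbb{K}$ is $\mathbb{R}$ or $\mathbb{C}$; $\mathbb{N}=\{1,2,3,\dots\}$. A Fréchet space is a vector space $X$ over $\mathbb{K}$ endowed with an increasing sequence $(\|\cdot\|_k)_{k\in\mathbb{N}}$ of seminorms such that $d(x,y):=\sum_{k=1}^{\infty}2^{-k}\min\{1,\|x-y\|_k\}$ is a metric under which $X$ is complete; this $d$ is called the compatible metric. A Fréchet sequence space is a Fréchet space $X$ that is a vector subspace of $\mathbb{K}^{\mathbb{N}}$ such that the inclusion $X\to\mathbb{K}^{\mathbb{N}}$ is continuous (convergence in $X$ implies coordinatewise convergence). The canonical vectors $e_n:=(\delta_{n,j})_{j\in\mathbb{N}}$, $n\in\mathbb{N}$, form a basis of $X$ if they belong to $X$ and $x=\sum_{n=1}^{\infty}x_ne_n$ in $X$ for every $x=(x_n)_{n\in\mathbb{N}}\in X$. For a sequence $w=(w_n)_{n\in\mathbb{N}}$ of nonzero scalars, the unilateral weighted backward shift is $B_w(x_1,x_2,x_3,\dots):=(w_1x_2,w_2x_3,w_3x_4,\dots)$; it is well-defined on $X$ if it maps $X$ into itself. A continuous map $f:M\to M$ on a metric space $(M,d)$ is mean Li--Yorke chaotic if there exists an uncountable set $S\subset M$ such that every pair $(x,y)\in S\times S$ of distinct points satisfies $$\liminf_{n\to\infty}\frac1n\sum_{k=1}^{n}d(f^k(x),f^k(y))=0\quad\text{and}\quad\limsup_{n\to\infty}\frac1n\sum_{k=1}^{n}d(f^k(x),f^k(y))>0.$$ *)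

theory Defs
  imports "HOL-Analysis.Analysis" "HOL-Library.Function_Algebras"
begin

(* Indices start at 0: term n of a sequence, weight w n and seminorm p n stand for the
   (n+1)-st term, weight and seminorm in the numbering by 1, 2, 3, ... *)

(* The value 0 outside X is a dummy: the locale Metric_space asks for nonnegativity and
   symmetry on the whole type, while p is only meaningful on X. *)
definition compatible_metric ::
    "'b::ab_group_add set \<Rightarrow> (nat \<Rightarrow> 'b \<Rightarrow> real) \<Rightarrow> 'b \<Rightarrow> 'b \<Rightarrow> real" where
  "compatible_metric X p x y =
     (if x \<in> X \<and> y \<in> X then (\<Sum>k. (1/2) ^ Suc k * min 1 (p k (x - y))) else 0)"

locale frechet_space =
  vector_space scale + Metric_space X "compatible_metric X p"
  for scale :: "'k::real_normed_field \<Rightarrow> 'b::ab_group_add \<Rightarrow> 'b"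
    and X :: "'b set" and p :: "nat \<Rightarrow> 'b \<Rightarrow> real" +
  assumes subspace_carrier: "subspace X"
    and seminorm_nonneg: "x \<in> X \<Longrightarrow> 0 \<le> p k x"
    and seminorm_scale: "x \<in> X \<Longrightarrow> p k (scale c x) = norm c * p k x"
    and seminorm_triangle: "x \<in> X \<Longrightarrow> y \<in> X \<Longrightarrow> p k (x + y) \<le> p k x + p k y"
    and seminorm_increasing: "x \<in> X \<Longrightarrow> p k x \<le> p (Suc k) x"
    and complete: "mcomplete"

definition seq_scale :: "'k::real_normed_field \<Rightarrow> (nat \<Rightarrow> 'k) \<Rightarrow> nat \<Rightarrow> 'k" where
  "seq_scale c x = (\<lambda>n. c * x n)"

lemma vector_space_seq_scale: "vector_space seq_scale"
  by unfold_locales (auto simp: seq_scale_def fun_eq_iff algebra_simps)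

locale frechet_sequence_space = frechet_space seq_scale X p
  for X :: "(nat \<Rightarrow> 'k::real_normed_field) set" and p +
  assumes continuous_inclusion:
    "continuous_map mtopology (product_topology (\<lambda>_. euclidean) UNIV) (\<lambda>x. x)"

definition canonical_vec :: "nat \<Rightarrow> nat \<Rightarrow> 'k::real_normed_field" where
  "canonical_vec n = (\<lambda>j. if j = n then 1 else 0)"

definition canonical_basis ::
    "(nat \<Rightarrow> 'k::real_normed_field) set \<Rightarrow> (nat \<Rightarrow> (nat \<Rightarrow> 'k) \<Rightarrow> real) \<Rightarrow> bool" where
  "canonical_basis X p \<longleftrightarrow>
     (\<forall>n. canonical_vec n \<in> X) \<and>
     (\<forall>x\<in>X. limitin (Metric_space.mtopology X (compatible_metric X p))
              (\<lambda>n. \<Sum>i<n. seq_scale (x i) (canonical_vec i)) x sequentially)"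

definition weighted_shift ::
    "(nat \<Rightarrow> 'k::real_normed_field) \<Rightarrow> (nat \<Rightarrow> 'k) \<Rightarrow> nat \<Rightarrow> 'k" where
  "weighted_shift w x = (\<lambda>n. w n * x (Suc n))"

definition (in Metric_space) mean_Li_Yorke_chaotic :: "('a \<Rightarrow> 'a) \<Rightarrow> bool" where
  "mean_Li_Yorke_chaotic f \<longleftrightarrow>
     continuous_map mtopology mtopology f \<and>
     (\<exists>S\<subseteq>M. uncountable S \<and>
        (\<forall>x\<in>S. \<forall>y\<in>S. x \<noteq> y \<longrightarrow>
           liminf (\<lambda>n. ereal (1 / real n * (\<Sum>k=1..n. d ((f ^^ k) x) ((f ^^ k) y)))) = 0 \<and>
           limsup (\<lambda>n. ereal (1 / real n * (\<Sum>k=1..n. d ((f ^^ k) x) ((f ^^ k) y)))) > 0))"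

end

theory Submission
  imports Defs
begin

text \<open>Write \<open>|x| = d(x, 0)\<close> and \<open>A(x, n)\<close> for the average of \<open>|T^i x|\<close> over \<open>1 \<le> i \<le> n\<close>. Chaos is
equivalent to the existence of a single vector \<open>x\<close> with \<open>liminf A(x, n) = 0 < limsup A(x, n)\<close>: differences
of scrambled pairs are such vectors, and conversely the line through \<open>x\<close> is a scrambled set.

Given such an \<open>x\<close>, some iterate \<open>T^m x\<close> is arbitrarily small and still has the same large averages;
truncating it gives the vectors of the condition. Conversely, the sum of a rapidly chosen
subsequence of the vectors in the condition works. Finitely supported vectors have vanishing averages in the long
run, so between two summands one may wait until the average of the current partial sum is negligible,
and the next summand is chosen so small that its orbit is negligible up to that time.\<close>

section \<open>Lower and upper limits of real sequences in epsilon form\<close>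

lemma liminf_ereal_eq_0_iff:
  fixes a :: "nat \<Rightarrow> real"
  assumes "\<And>n. 0 \<le> a n"
  shows "liminf (\<lambda>n. ereal (a n)) = 0 \<longleftrightarrow> (\<forall>e>0. \<forall>m. \<exists>n\<ge>m. a n < e)" (is "?L \<longleftrightarrow> ?R")
proof -
  have ge: "liminf (\<lambda>n. ereal (a n)) \<ge> 0"
    using assms by (auto intro!: Liminf_bounded)
  \<comment> \<open>Nonnegativity already bounds the lower limit below by 0, so only the question
    when it is positive remains.\<close>
  have "liminf (\<lambda>n. ereal (a n)) > 0 \<longleftrightarrow> \<not> ?R"
  proof
    assume "liminf (\<lambda>n. ereal (a n)) > 0"
    then obtain c where c: "0 < ereal c" "ereal c < liminf (\<lambda>n. ereal (a n))"
      using ereal_dense2 by blast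
    then have "eventually (\<lambda>n. c < a n) sequentially"
      using less_LiminfD[OF c(2)] by simp
    then obtain m where "\<And>n. n \<ge> m \<Longrightarrow> c < a n"
      by (auto simp: eventually_sequentially)
    with c(1) show "\<not> ?R"
      by (metis ereal_less(2) less_asym)
  next
    assume "\<not> ?R"
    then obtain e m where e: "e > 0" "\<And>n. n \<ge> m \<Longrightarrow> e \<le> a n"
      by (metis not_less)
    then have "liminf (\<lambda>n. ereal (a n)) \<ge> ereal e"
      by (intro Liminf_bounded) (auto simp: eventually_sequentially)
    with e(1) show "liminf (\<lambda>n. ereal (a n)) > 0"
      by (metis ereal_less(2) less_le_trans)
  qed
  with ge show ?thesis
    by (metis less_le)
qed

lemma limsup_ereal_pos_iff:
  fixes a :: "nat \<Rightarrow> real"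
  shows "limsup (\<lambda>n. ereal (a n)) > 0 \<longleftrightarrow> (\<exists>c>0. \<forall>m. \<exists>n\<ge>m. c \<le> a n)" (is "?L \<longleftrightarrow> ?R")
proof
  assume ?L
  then obtain c where c: "0 < ereal c" "ereal c < limsup (\<lambda>n. ereal (a n))"
    using ereal_dense2 by blast
  have "\<exists>n\<ge>m. c \<le> a n" for m
  proof (rule ccontr)
    assume "\<not> (\<exists>n\<ge>m. c \<le> a n)"
    then have "a n \<le> c" if "n \<ge> m" for n
      using that by force
    then have "limsup (\<lambda>n. ereal (a n)) \<le> ereal c"
      by (intro Limsup_bounded) (auto simp: eventually_sequentially intro!: exI[of _ m])
    with c(2) show False by simp
  qed
  with c(1) show ?R by auto
next
  assume ?R
  then obtain c where c: "c > 0" "\<And>m. \<exists>n\<ge>m. c \<le> a n" by blast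
  show ?L
  proof (rule ccontr)
    assume "\<not> ?L"
    then have "limsup (\<lambda>n. ereal (a n)) < ereal c"
      using c(1) by (metis ereal_less(2) not_less le_less_trans)
    then have "eventually (\<lambda>n. a n < c) sequentially"
      using Limsup_lessD by fastforce
    then show False
      using c(2) by (metis eventually_sequentially not_less)
  qed
qed

section \<open>The bounded F-norm behind the metric\<close>

context frechet_space
begin

lemma zero_in_carrier [simp]: "0 \<in> X"
  and add_in_carrier [simp]: "x \<in> X \<Longrightarrow> y \<in> X \<Longrightarrow> x + y \<in> X"
  and scale_in_carrier [simp]: "x \<in> X \<Longrightarrow> scale c x \<in> X"
  using subspace_carrier by (auto simp: subspace_def)

lemma diff_in_carrier [simp]: "x \<in> X \<Longrightarrow> y \<in> X \<Longrightarrow> x - y \<in> X"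
  by (rule subspace_diff[OF subspace_carrier])

text \<open>On \<open>X\<close> the metric depends only on differences, so the distance to 0 carries
  all of it. It is subadditive and bounded by 1, but in general not homogeneous.\<close>

definition fnorm :: "'b \<Rightarrow> real" where
  "fnorm x = compatible_metric X p x 0"

lemma fnorm_zero [simp]: "fnorm 0 = 0"
  by (simp add: fnorm_def)

lemma compatible_metric_eq_fnorm:
  assumes "x \<in> X" "y \<in> X"
  shows "compatible_metric X p x y = fnorm (x - y)"
  using assms by (simp add: fnorm_def compatible_metric_def)

lemma fnorm_nonneg [simp]: "0 \<le> fnorm x"
  by (simp add: fnorm_def)

lemma fnorm_summable:
  assumes "x \<in> X"
  shows "summable (\<lambda>k. (1/2) ^ Suc k * min 1 (p k x))"
proof (rule summable_comparison_test')
  show "summable (\<lambda>k. (1/2::real) ^ Suc k)"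
    using power_half_series sums_summable by blast
  show "norm ((1/2) ^ Suc k * min 1 (p k x)) \<le> (1/2) ^ Suc k" for k
    using seminorm_nonneg[OF assms, of k] by (auto simp: mult_le_cancel_left1)
qed

lemma fnorm_le_1: "fnorm x \<le> 1"
proof (cases "x \<in> X")
  case True
  have "(\<Sum>k. (1/2) ^ Suc k * min 1 (p k x)) \<le> (\<Sum>k. (1/2::real) ^ Suc k)"
    using power_half_series sums_summable
    by (intro suminf_le fnorm_summable True) (auto simp: mult_le_cancel_left1)
  also have "\<dots> = 1"
    using power_half_series sums_unique by metis
  finally show ?thesis
    using True by (simp add: fnorm_def compatible_metric_def)
qed (simp add: fnorm_def compatible_metric_def)

lemma fnorm_triangle:
  assumes "x \<in> X" "y \<in> X"
  shows "fnorm (x + y) \<le> fnorm x + fnorm y"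
  using triangle[of "x + y" y 0] assms by (simp add: compatible_metric_eq_fnorm)

lemma fnorm_minus_commute:
  assumes "x \<in> X" "y \<in> X"
  shows "fnorm (x - y) = fnorm (y - x)"
  using commute[of x y] assms by (simp add: compatible_metric_eq_fnorm)

lemma fnorm_triangle_sub:
  assumes "x \<in> X" "y \<in> X"
  shows "fnorm x \<le> fnorm y + fnorm (x - y)"
  using fnorm_triangle[of y "x - y"] assms by simp

text \<open>Substitute for homogeneity, which the truncation at 1 destroys. Termwise it is
  \<open>min 1 (C * t) \<le> max 1 C * min 1 t\<close> for \<open>C, t \<ge> 0\<close>.\<close>

lemma fnorm_scale_le:
  assumes "x \<in> X"
  shows "fnorm (scale c x) \<le> max 1 (norm c) * fnorm x"
proof -
  have "min 1 (norm c * p k x) \<le> max 1 (norm c) * min 1 (p k x)" for k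
  proof -
    have "norm c * p k x \<le> max 1 (norm c) * p k x"
      using seminorm_nonneg[OF assms] by (intro mult_right_mono) auto
    then show ?thesis
      by (auto simp: min_def)
  qed
  then have "(\<Sum>k. (1/2) ^ Suc k * min 1 (p k (scale c x)))
      \<le> (\<Sum>k. max 1 (norm c) * ((1/2) ^ Suc k * min 1 (p k x)))"
    using assms by (intro suminf_le summable_mult fnorm_summable)
      (auto simp: seminorm_scale mult.left_commute)
  also have "\<dots> = max 1 (norm c) * (\<Sum>k. (1/2) ^ Suc k * min 1 (p k x))"
    by (rule suminf_mult[OF fnorm_summable[OF assms]])
  finally show ?thesis
    using assms by (simp add: fnorm_def compatible_metric_def)
qed

end

section \<open>Averages along the orbits of a continuous linear operator\<close>

locale frechet_operator = frechet_space scale X p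
  for scale :: "'k::real_normed_field \<Rightarrow> 'b::ab_group_add \<Rightarrow> 'b"
    and X :: "'b set" and p :: "nat \<Rightarrow> 'b \<Rightarrow> real" +
  fixes T :: "'b \<Rightarrow> 'b"
  assumes T_continuous: "continuous_map mtopology mtopology T"
    and T_add: "x \<in> X \<Longrightarrow> y \<in> X \<Longrightarrow> T (x + y) = T x + T y"
    and T_scale: "x \<in> X \<Longrightarrow> T (scale c x) = scale c (T x)"
begin

lemma T_in_carrier: "x \<in> X \<Longrightarrow> T x \<in> X"
  using T_continuous by (auto simp: continuous_map_def)

lemma iter_in_carrier [simp]: "x \<in> X \<Longrightarrow> (T ^^ i) x \<in> X"
  by (induction i) (auto simp: T_in_carrier)

lemma iter_add: "x \<in> X \<Longrightarrow> y \<in> X \<Longrightarrow> (T ^^ i) (x + y) = (T ^^ i) x + (T ^^ i) y"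
  by (induction i) (auto simp: T_add)

lemma iter_scale: "x \<in> X \<Longrightarrow> (T ^^ i) (scale c x) = scale c ((T ^^ i) x)"
  by (induction i) (auto simp: T_scale)

lemma iter_diff: "x \<in> X \<Longrightarrow> y \<in> X \<Longrightarrow> (T ^^ i) (x - y) = (T ^^ i) x - (T ^^ i) y"
  using iter_add[of "x - y" y i] by simp

lemma iter_zero [simp]: "(T ^^ i) 0 = 0"
  using iter_diff[of 0 0 i] by simp

lemma iter_continuous: "continuous_map mtopology mtopology (T ^^ i)"
proof (induction i)
  case (Suc i)
  then show ?case
    unfolding funpow.simps by (rule continuous_map_compose[OF _ T_continuous])
qed (simp add: id_def)

text \<open>Each iterate is continuous at 0, and finitely many radii have a positive minimum. This
  allows a summand to be chosen so small that it stays negligible up to a prescribed time.\<close>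

lemma iter_small:
  assumes "0 < e"
  shows "\<exists>\<delta>>0. \<forall>u\<in>X. fnorm u < \<delta> \<longrightarrow> (\<forall>i\<le>m. fnorm ((T ^^ i) u) < e)"
proof (induction m)
  have *: "\<exists>\<delta>>0. \<forall>u\<in>X. fnorm u < \<delta> \<longrightarrow> fnorm ((T ^^ i) u) < e" for i
  proof -
    obtain \<delta> where "\<delta> > 0" "\<And>u. u \<in> X \<Longrightarrow> compatible_metric X p 0 u < \<delta> \<Longrightarrow>
        compatible_metric X p ((T ^^ i) 0) ((T ^^ i) u) < e"
      using iter_continuous[of i] assms zero_in_carrier
      unfolding metric_continuous_map[OF Metric_space_axioms] by meson
    then show ?thesis
      unfolding fnorm_def iter_zero using commute by metis
  qed
  {
    case 0
    show ?case using *[of 0] by simp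
  next
    case (Suc m)
    then obtain \<delta> where "\<delta> > 0" "\<forall>u\<in>X. fnorm u < \<delta> \<longrightarrow> (\<forall>i\<le>m. fnorm ((T ^^ i) u) < e)" by blast
    moreover obtain \<delta>' where "\<delta>' > 0" "\<forall>u\<in>X. fnorm u < \<delta>' \<longrightarrow> fnorm ((T ^^ Suc m) u) < e"
      using *[of "Suc m"] by blast
    ultimately show ?case
      by (intro exI[of _ "min \<delta> \<delta>'"]) (auto simp: le_Suc_eq)
  }
qed

definition orbit_mean :: "'b \<Rightarrow> nat \<Rightarrow> real" where
  "orbit_mean x n = 1 / real n * (\<Sum>i=1..n. fnorm ((T ^^ i) x))"

lemma orbit_mean_nonneg: "0 \<le> orbit_mean x n"
  unfolding orbit_mean_def by (intro mult_nonneg_nonneg sum_nonneg) auto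

text \<open>The triangle inequality for each term. Closeness is asked only up to time
  \<open>n\<close>, which is what \<open>iter_small\<close> can provide.\<close>

lemma orbit_mean_perturb:
  assumes "x \<in> X" "y \<in> X" "0 \<le> c" "\<And>i. i \<le> n \<Longrightarrow> fnorm ((T ^^ i) (x - y)) \<le> c"
  shows "orbit_mean x n \<le> orbit_mean y n + c"
proof -
  have "(\<Sum>i=1..n. fnorm ((T ^^ i) x)) \<le> (\<Sum>i=1..n. fnorm ((T ^^ i) y) + c)"
  proof (rule sum_mono)
    fix i assume "i \<in> {1..n}"
    then show "fnorm ((T ^^ i) x) \<le> fnorm ((T ^^ i) y) + c"
      using fnorm_triangle_sub[of "(T ^^ i) x" "(T ^^ i) y"] assms(4)[of i] assms(1,2)
      by (auto simp: iter_diff)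
  qed
  also have "\<dots> = (\<Sum>i=1..n. fnorm ((T ^^ i) y)) + real n * c"
    by (simp add: sum.distrib)
  finally show ?thesis
    using assms(3) by (cases "n = 0") (auto simp: orbit_mean_def field_simps)
qed

lemma orbit_mean_triangle:
  assumes "x \<in> X" "y \<in> X"
  shows "orbit_mean (x + y) n \<le> orbit_mean x n + orbit_mean y n"
  unfolding orbit_mean_def distrib_left[symmetric] sum.distrib[symmetric]
  using assms by (intro mult_left_mono sum_mono) (auto simp: iter_add fnorm_triangle)

lemma orbit_mean_scale_le:
  assumes "x \<in> X"
  shows "orbit_mean (scale c x) n \<le> max 1 (norm c) * orbit_mean x n"
proof -
  have "(\<Sum>i=1..n. fnorm ((T ^^ i) (scale c x))) \<le> (\<Sum>i=1..n. max 1 (norm c) * fnorm ((T ^^ i) x))"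
    using assms by (intro sum_mono) (auto simp: iter_scale fnorm_scale_le)
  then have "1 / real n * (\<Sum>i=1..n. fnorm ((T ^^ i) (scale c x)))
      \<le> 1 / real n * (max 1 (norm c) * (\<Sum>i=1..n. fnorm ((T ^^ i) x)))"
    by (intro mult_left_mono) (auto simp: sum_distrib_left)
  then show ?thesis
    by (simp add: orbit_mean_def mult.left_commute)
qed

text \<open>Enlarge the sum to \<open>n + m\<close> terms: the first \<open>m\<close> cost at most 1
  each because \<open>fnorm\<close> is bounded by 1, and the other \<open>n\<close> form the orbit
  of \<open>(T ^^ m) x\<close>.\<close>

lemma orbit_mean_shift:
  assumes "x \<in> X" "n > 0"
  shows "orbit_mean x n \<le> orbit_mean ((T ^^ m) x) n + real m / real n"
proof -
  have "(\<Sum>i=1..n. fnorm ((T ^^ i) x)) \<le> (\<Sum>i=1..n+m. fnorm ((T ^^ i) x))"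
    by (intro sum_mono2) auto
  also have "\<dots> = (\<Sum>i\<in>{1..m}. fnorm ((T ^^ i) x)) + (\<Sum>i\<in>{1+m..n+m}. fnorm ((T ^^ i) x))"
    by (subst sum.union_disjoint[symmetric]) (auto intro!: sum.cong)
  also have "(\<Sum>i\<in>{1+m..n+m}. fnorm ((T ^^ i) x)) = (\<Sum>i=1..n. fnorm ((T ^^ i) ((T ^^ m) x)))"
    unfolding sum.shift_bounds_cl_nat_ivl by (simp add: funpow_add)
  also have "(\<Sum>i\<in>{1..m}. fnorm ((T ^^ i) x)) \<le> real m"
    using sum_mono[of "{1..m}" "\<lambda>i. fnorm ((T ^^ i) x)" "\<lambda>_. 1"] fnorm_le_1 by simp
  finally have "(\<Sum>i=1..n. fnorm ((T ^^ i) x)) \<le> real m + (\<Sum>i=1..n. fnorm ((T ^^ i) ((T ^^ m) x)))"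
    by simp
  then show ?thesis
    using assms(2) by (auto simp: orbit_mean_def field_simps)
qed

text \<open>After \<open>s\<close> steps the orbit consists of zeros. Hence the means of a fixed
  such vector tend to 0.\<close>

lemma orbit_mean_nilpotent:
  assumes "x \<in> X" "(T ^^ s) x = 0" "n > 0"
  shows "orbit_mean x n \<le> real s / real n"
  using orbit_mean_shift[OF assms(1,3), of s] assms(2) by (simp add: orbit_mean_def)

lemma orbit_mean_diff:
  assumes "x \<in> X" "y \<in> X"
  shows "1 / real n * (\<Sum>k=1..n. compatible_metric X p ((T ^^ k) x) ((T ^^ k) y)) = orbit_mean (x - y) n"
  unfolding orbit_mean_def using assms by (simp add: compatible_metric_eq_fnorm iter_diff)

section \<open>Mean irregular vectors and scrambled sets\<close>

definition mean_irregular :: "'b \<Rightarrow> bool" where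
  "mean_irregular x \<longleftrightarrow> x \<in> X \<and>
     (\<forall>e>0. \<forall>m. \<exists>n\<ge>m. orbit_mean x n < e) \<and> (\<exists>c>0. \<forall>m. \<exists>n\<ge>m. c \<le> orbit_mean x n)"

text \<open>By linearity the orbits of \<open>x\<close> and \<open>y\<close> differ by the orbit of
  \<open>x - y\<close>, so the condition on a pair concerns only its difference. The two limit
  lemmas then turn it into epsilon form.\<close>

lemma mean_Li_Yorke_chaotic_iff_scrambled:
  "mean_Li_Yorke_chaotic T \<longleftrightarrow>
     (\<exists>S\<subseteq>X. uncountable S \<and> (\<forall>x\<in>S. \<forall>y\<in>S. x \<noteq> y \<longrightarrow> mean_irregular (x - y)))"
proof -
  let ?a = "\<lambda>x y n. ereal (1 / real n * (\<Sum>k=1..n. compatible_metric X p ((T ^^ k) x) ((T ^^ k) y)))"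
  have *: "liminf (?a x y) = 0 \<and> limsup (?a x y) > 0 \<longleftrightarrow> mean_irregular (x - y)"
    if "x \<in> X" "y \<in> X" for x y
    using that
    by (simp only: orbit_mean_diff liminf_ereal_eq_0_iff[OF orbit_mean_nonneg] limsup_ereal_pos_iff
        mean_irregular_def) simp
  have "(\<forall>x\<in>S. \<forall>y\<in>S. x \<noteq> y \<longrightarrow> liminf (?a x y) = 0 \<and> limsup (?a x y) > 0) \<longleftrightarrow>
      (\<forall>x\<in>S. \<forall>y\<in>S. x \<noteq> y \<longrightarrow> mean_irregular (x - y))" if "S \<subseteq> X" for S
    using that by (intro ball_cong refl imp_cong *) auto
  then show ?thesis
    unfolding mean_Li_Yorke_chaotic_def using T_continuous by (simp only: simp_thms cong: conj_cong)
qed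

lemma mean_irregular_scale:
  assumes x: "mean_irregular x" and "c \<noteq> 0"
  shows "mean_irregular (scale c x)"
proof -
  have X: "x \<in> X" using x by (simp add: mean_irregular_def)
  define C where "C = max 1 (norm c)"
  define D where "D = max 1 (norm (inverse c))"
  have pos: "C > 0" "D > 0" by (auto simp: C_def D_def)
  have "\<exists>n\<ge>m. orbit_mean (scale c x) n < e" if "e > 0" for e m
  proof -
    have "e / C > 0" using that pos by simp
    then obtain n where "n \<ge> m" "orbit_mean x n < e / C"
      using x unfolding mean_irregular_def by blast
    moreover have "orbit_mean (scale c x) n \<le> C * orbit_mean x n"
      using orbit_mean_scale_le[OF X] by (simp add: C_def)
    ultimately show ?thesis
      using pos by (auto simp: field_simps intro!: exI[of _ n])
  qed
  moreover obtain b where b: "b > 0" "\<And>m. \<exists>n\<ge>m. b \<le> orbit_mean x n"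
    using x unfolding mean_irregular_def by blast
  \<comment> \<open>The lower bound comes from the same scaling estimate, applied to the way back
    from \<open>scale c x\<close> to \<open>x\<close> by \<open>inverse c\<close>.\<close>
  have "b / D \<le> orbit_mean (scale c x) n" if "b \<le> orbit_mean x n" for n
  proof -
    have "orbit_mean (scale (inverse c) (scale c x)) n \<le> D * orbit_mean (scale c x) n"
      unfolding D_def by (rule orbit_mean_scale_le) (simp add: X)
    then show ?thesis
      using that pos \<open>c \<noteq> 0\<close> by (simp add: field_simps)
  qed
  then have "\<exists>b>0. \<forall>m. \<exists>n\<ge>m. b \<le> orbit_mean (scale c x) n"
    using b pos by (metis divide_pos_pos)
  ultimately show ?thesis
    using X by (auto simp: mean_irregular_def)
qed

lemma mean_irregular_nonzero: "mean_irregular x \<Longrightarrow> x \<noteq> 0"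
  by (auto simp: mean_irregular_def orbit_mean_def)

theorem mean_Li_Yorke_chaotic_iff_irregular:
  "mean_Li_Yorke_chaotic T \<longleftrightarrow> (\<exists>x. mean_irregular x)"
proof
  assume "mean_Li_Yorke_chaotic T"
  then obtain S where S: "uncountable S" "\<And>x y. x \<in> S \<Longrightarrow> y \<in> S \<Longrightarrow> x \<noteq> y \<Longrightarrow> mean_irregular (x - y)"
    unfolding mean_Li_Yorke_chaotic_iff_scrambled by blast
  obtain x where "x \<in> S" using S(1) by fastforce
  moreover have "S - {x} \<noteq> {}"
    using S(1) by (metis countable_empty uncountable_minus_countable countable_finite finite.intros)
  then obtain y where "y \<in> S - {x}" by blast
  ultimately show "\<exists>x. mean_irregular x" using S(2) by blast
next
  assume "\<exists>x. mean_irregular x"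
  then obtain x where x: "mean_irregular x" ..
  have X: "x \<in> X" using x by (simp add: mean_irregular_def)
  \<comment> \<open>Real multiples of \<open>x\<close> already form an uncountable set, and two
    distinct ones differ by a nonzero multiple of \<open>x\<close>.\<close>
  define f :: "real \<Rightarrow> 'b" where "f t = scale (of_real t) x" for t
  have diff: "f s - f t = scale (of_real (s - t)) x" for s t
    by (simp add: f_def scale_left_diff_distrib)
  have "inj f"
  proof (rule injI)
    fix s t assume "f s = f t"
    then show "s = t"
      using diff[of s t] mean_irregular_nonzero[OF x] by auto
  qed
  then have "uncountable (range f)"
    using uncountable_UNIV_real countable_image_inj_eq by blast
  moreover have "mean_irregular (u - v)" if "u \<in> range f" "v \<in> range f" "u \<noteq> v" for u v
    using that by (auto simp: diff intro!: mean_irregular_scale[OF x] simp del: of_real_diff)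
  moreover have "range f \<subseteq> X" using X by (auto simp: f_def)
  ultimately show "mean_Li_Yorke_chaotic T"
    unfolding mean_Li_Yorke_chaotic_iff_scrambled by blast
qed

section \<open>Construction of irregular vectors and the criterion for chaos\<close>

text \<open>Here \<open>v\<close> plays the role of the partial sums, and up to time
  \<open>m j\<close> all summands after \<open>v j\<close> are negligible. The limit therefore
  inherits the small mean of \<open>v j\<close> at time \<open>m j\<close> and the large one at time
  \<open>n j\<close>.\<close>

lemma irregular_limit:
  assumes v: "\<And>j. v j \<in> X"
    and step: "\<And>j i. i \<le> m j \<Longrightarrow> fnorm ((T ^^ i) (v (Suc j) - v j)) \<le> (1/2) ^ j"
    and m: "strict_mono m"
    and small: "\<And>j. orbit_mean (v j) (m j) \<le> (1/2) ^ j"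
    and n: "\<And>j. j \<le> n j" "\<And>j. n j \<le> m j"
    and "c > 0" and large: "\<And>j. c \<le> orbit_mean (v (Suc j)) (n (Suc j))"
  shows "\<exists>x. mean_irregular x"
proof -
  \<comment> \<open>The bound is the exact geometric sum of the \<open>k\<close> increments; keeping
    the subtracted term makes the induction go through.\<close>
  have tail: "fnorm ((T ^^ i) (v (j + k) - v j)) \<le> 2 * (1/2) ^ j - 2 * (1/2) ^ (j + k)" if "i \<le> m j" for i j k
  proof (induction k)
    case (Suc k)
    have "i \<le> m (j + k)"
      using that m by (meson le_add1 le_trans strict_mono_less_eq)
    then have "fnorm ((T ^^ i) (v (Suc (j + k)) - v (j + k))) \<le> (1/2) ^ (j + k)" by (rule step)
    moreover have "(T ^^ i) (v (Suc (j + k)) - v j)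
        = (T ^^ i) (v (Suc (j + k)) - v (j + k)) + (T ^^ i) (v (j + k) - v j)"
      by (simp add: iter_diff v)
    ultimately show ?case
      using Suc fnorm_triangle[of "(T ^^ i) (v (Suc (j + k)) - v (j + k))" "(T ^^ i) (v (j + k) - v j)"]
      by (simp add: v)
  qed simp
  then have tail': "fnorm ((T ^^ i) (v k - v j)) \<le> 2 * (1/2) ^ j" if "i \<le> m j" "j \<le> k" for i j k
  proof -
    have "fnorm ((T ^^ i) (v k - v j)) \<le> 2 * (1/2) ^ j - 2 * (1/2) ^ k"
      using tail[OF that(1), of "k - j"] that(2) by simp
    moreover have "0 \<le> (1/2::real) ^ k" by simp
    ultimately show ?thesis by linarith
  qed
  have pow_small: "\<exists>j\<ge>k. 4 * (1/2) ^ j < (e::real)" if "e > 0" for e k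
  proof -
    have "(\<lambda>j. 4 * (1/2::real) ^ j) \<longlonglongrightarrow> 4 * 0"
      by (intro tendsto_intros LIMSEQ_power_zero) auto
    from order_tendstoD(2)[OF this, of e] that obtain l where "\<And>j. j \<ge> l \<Longrightarrow> 4 * (1/2) ^ j < e"
      by (auto simp: eventually_sequentially)
    then show ?thesis
      by (intro exI[of _ "max k l"]) auto
  qed
  \<comment> \<open>This is the tail estimate at time 0, where the iterate is the identity.\<close>
  have "MCauchy v"
    unfolding MCauchy_def
  proof (intro conjI allI impI)
    fix e :: real assume "e > 0"
    then obtain J where J: "4 * (1/2) ^ J < e" using pow_small by blast
    have "compatible_metric X p (v k) (v k') < e" if "J \<le> k" "J \<le> k'" for k k'
    proof -
      have "compatible_metric X p (v k) (v k') \<le> fnorm (v k - v J) + fnorm (v k' - v J)"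
        using triangle[of "v k" "v J" "v k'"] v
        by (simp add: compatible_metric_eq_fnorm fnorm_minus_commute[of "v J" "v k'"])
      also have "\<dots> \<le> 2 * (1/2) ^ J + 2 * (1/2) ^ J"
        using tail'[of 0 J k] tail'[of 0 J k'] that by simp
      finally show ?thesis using J by simp
    qed
    then show "\<exists>N. \<forall>n n'. N \<le> n \<longrightarrow> N \<le> n' \<longrightarrow> compatible_metric X p (v n) (v n') < e" by blast
  qed (use v in auto)
  then obtain x where x: "limitin mtopology v x sequentially"
    using complete by (auto simp: mcomplete_def)
  then have xX: "x \<in> X" by (simp add: limitin_mspace)
  \<comment> \<open>The tail estimate passes to the limit because \<open>T ^^ i\<close> is
    continuous: \<open>x\<close> is compared with a late term \<open>v (K + j)\<close>.\<close>
  have close: "fnorm ((T ^^ i) (x - v j)) \<le> 2 * (1/2) ^ j" if "i \<le> m j" for i j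
  proof (rule field_le_epsilon)
    fix e :: real assume "e > 0"
    have "limitin mtopology ((T ^^ i) \<circ> v) ((T ^^ i) x) sequentially"
      by (rule continuous_map_limit[OF iter_continuous x])
    then obtain K where "\<And>k. k \<ge> K \<Longrightarrow> compatible_metric X p ((T ^^ i) (v k)) ((T ^^ i) x) < e"
      using \<open>e > 0\<close> by (force simp: limit_metric_sequentially)
    then have "compatible_metric X p ((T ^^ i) (v (K + j))) ((T ^^ i) x) < e" by simp
    then have "fnorm ((T ^^ i) x - (T ^^ i) (v (K + j))) < e"
      using v xX by (simp add: compatible_metric_eq_fnorm fnorm_minus_commute)
    moreover have "fnorm ((T ^^ i) (v (K + j)) - (T ^^ i) (v j)) \<le> 2 * (1/2) ^ j"
      using tail'[of i j "K + j"] that v by (simp add: iter_diff)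
    ultimately show "fnorm ((T ^^ i) (x - v j)) \<le> 2 * (1/2) ^ j + e"
      using fnorm_triangle[of "(T ^^ i) x - (T ^^ i) (v (K + j))" "(T ^^ i) (v (K + j)) - (T ^^ i) (v j)"] v xX
      by (simp add: iter_diff)
  qed
  have "\<exists>n\<ge>k. orbit_mean x n < e" if "e > 0" for e k
  proof -
    obtain j where j: "j \<ge> k" "4 * (1/2) ^ j < e"
      using pow_small[OF \<open>e > 0\<close>] by blast
    have "orbit_mean x (m j) \<le> orbit_mean (v j) (m j) + 2 * (1/2) ^ j"
      by (rule orbit_mean_perturb) (auto simp: v xX close)
    also have "\<dots> \<le> 4 * (1/2) ^ j"
      using small[of j] by (simp add: field_simps)
    finally show ?thesis
      using j n[of j] by (intro exI[of _ "m j"] conjI) linarith+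
  qed
  moreover have "\<exists>n\<ge>k. c / 2 \<le> orbit_mean x n" for k
  proof -
    \<comment> \<open>Large means are given only at successor indices. The factor 4 keeps the loss
      \<open>2 * (1/2) ^ j'\<close> below \<open>c / 2\<close>.\<close>
    obtain j' where j': "j' \<ge> Suc k" "4 * (1/2) ^ j' < c"
      using pow_small[OF \<open>c > 0\<close>] by blast
    then obtain j where "j' = Suc j" by (cases j') auto
    with j' have j: "Suc j \<ge> k" "4 * (1/2) ^ Suc j < c" by auto
    have "c \<le> orbit_mean (v (Suc j)) (n (Suc j))" by (rule large)
    also have "\<dots> \<le> orbit_mean x (n (Suc j)) + 2 * (1/2) ^ Suc j"
    proof (rule orbit_mean_perturb)
      show "fnorm ((T ^^ i) (v (Suc j) - x)) \<le> 2 * (1/2) ^ Suc j" if "i \<le> n (Suc j)" for i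
        using close[of i "Suc j"] n(2)[of "Suc j"] that v xX
        by (simp add: iter_diff fnorm_minus_commute)
    qed (use v xX in auto)
    finally show ?thesis
      using j n(1)[of "Suc j"] by (intro exI[of _ "n (Suc j)"] conjI) linarith+
  qed
  ultimately have "mean_irregular x"
    unfolding mean_irregular_def using \<open>c > 0\<close> xX by (intro conjI exI[of _ "c / 2"]) auto
  then show ?thesis ..
qed

text \<open>\<open>D\<close> abstracts the finitely supported sequences; the power of
  \<open>T\<close> that annihilates a vector of \<open>D\<close> may depend on the vector.\<close>

theorem mean_Li_Yorke_chaotic_criterion:
  assumes D: "subspace D" "D \<subseteq> X"
    and nilpotent: "\<And>x. x \<in> D \<Longrightarrow> \<exists>s. (T ^^ s) x = 0"
    and dense: "\<And>x e. x \<in> X \<Longrightarrow> e > 0 \<Longrightarrow> \<exists>y\<in>D. fnorm (y - x) < e"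
  shows "mean_Li_Yorke_chaotic T \<longleftrightarrow>
     (\<exists>\<epsilon>>0. \<exists>N::nat \<Rightarrow> nat. strict_mono N \<and> (\<forall>k. N k > 0) \<and>
       (\<forall>k. \<exists>y\<in>D. fnorm y < 1 / real (Suc k) \<and> \<epsilon> \<le> orbit_mean y (N k)))"
    (is "?L \<longleftrightarrow> ?R")
proof
  assume ?L
  then obtain x where x: "mean_irregular x"
    using mean_Li_Yorke_chaotic_iff_irregular by blast
  then have X: "x \<in> X" by (simp add: mean_irregular_def)
  obtain c where c: "c > 0" "\<And>m. \<exists>n\<ge>m. c \<le> orbit_mean x n"
    using x unfolding mean_irregular_def by blast
  \<comment> \<open>The constant drops from \<open>c\<close> to \<open>c / 2\<close> on passing to
    an iterate, and to \<open>c / 4\<close> on approximating that iterate from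
    \<open>D\<close>.\<close>
  have ex: "\<exists>n>l. \<exists>y\<in>D. fnorm y < e \<and> c / 4 \<le> orbit_mean y n" if "e > 0" for e l
  proof -
    obtain n where n: "n \<ge> 1" "orbit_mean x n < e / 2"
      using x \<open>e > 0\<close> unfolding mean_irregular_def by (meson half_gt_zero)
    \<comment> \<open>A mean below \<open>e / 2\<close> must have a term below
      \<open>e / 2\<close>.\<close>
    have "\<exists>i. fnorm ((T ^^ i) x) < e / 2"
    proof (rule ccontr)
      assume "\<nexists>i. fnorm ((T ^^ i) x) < e / 2"
      then have "(\<Sum>i=1..n. e / 2) \<le> (\<Sum>i=1..n. fnorm ((T ^^ i) x))"
        by (intro sum_mono) (simp add: not_less)
      then have "e / 2 \<le> orbit_mean x n"
        using n(1) by (simp add: orbit_mean_def field_simps)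
      with n(2) show False by simp
    qed
    then obtain i where i: "fnorm ((T ^^ i) x) < e / 2" ..
    define u where "u = (T ^^ i) x"
    have u: "u \<in> X" using X by (simp add: u_def)
    \<comment> \<open>From \<open>n0\<close> on, the loss \<open>i / n\<close> caused by starting
      the orbit at \<open>u\<close> is at most \<open>c / 2\<close>.\<close>
    obtain n0 :: nat where n0: "real n0 > 2 * real i / c"
      using reals_Archimedean2 by blast
    obtain n where n: "n \<ge> max (Suc l) n0" "c \<le> orbit_mean x n" using c(2) by blast
    have "real n > 2 * real i / c" using n(1) n0 by linarith
    then have "real i / real n \<le> c / 2" using c(1) n(1) by (simp add: field_simps)
    moreover have "orbit_mean x n \<le> orbit_mean u n + real i / real n"
      unfolding u_def using n(1) by (intro orbit_mean_shift X) auto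
    ultimately have mean_u: "c / 2 \<le> orbit_mean u n"
      using n(2) by linarith
    obtain \<delta> where \<delta>: "\<delta> > 0" "\<And>z i. z \<in> X \<Longrightarrow> fnorm z < \<delta> \<Longrightarrow> i \<le> n \<Longrightarrow> fnorm ((T ^^ i) z) < c / 4"
      using iter_small[of "c / 4" n] c(1) by fastforce
    \<comment> \<open>The bound \<open>\<delta>\<close> controls the first \<open>n\<close> iterates
      of \<open>u - y\<close>; the bound \<open>e / 2\<close> adds to that of \<open>u\<close> to
      give \<open>fnorm y < e\<close>.\<close>
    obtain y where y: "y \<in> D" "fnorm (y - u) < min \<delta> (e / 2)"
      using dense[OF u, of "min \<delta> (e / 2)"] \<delta>(1) \<open>e > 0\<close> by auto
    have yX: "y \<in> X" using y(1) D(2) by blast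
    have "orbit_mean u n \<le> orbit_mean y n + c / 4"
    proof (rule orbit_mean_perturb)
      show "fnorm ((T ^^ i) (u - y)) \<le> c / 4" if "i \<le> n" for i
        using \<delta>(2)[of "u - y" i] y(2) u yX that fnorm_minus_commute[of y u] by simp
    qed (use u yX c in auto)
    moreover have "fnorm y < e"
      using fnorm_triangle_sub[OF yX u] y(2) i by (simp add: u_def)
    ultimately show ?thesis
      using mean_u n(1) y(1) by (intro exI[of _ n]) (auto intro!: bexI[of _ y])
  qed
  have "\<exists>N::nat \<Rightarrow> nat. \<forall>k. (0 < N k \<and> (\<exists>y\<in>D. fnorm y < 1 / real (Suc k) \<and> c / 4 \<le> orbit_mean y (N k)))
      \<and> N k < N (Suc k)"
  proof (rule dependent_nat_choice)
    show "\<exists>n>0. \<exists>y\<in>D. fnorm y < 1 / real (Suc 0) \<and> c / 4 \<le> orbit_mean y n"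
      by (rule ex) simp
    show "\<exists>n'. (0 < n' \<and> (\<exists>y\<in>D. fnorm y < 1 / real (Suc (Suc k)) \<and> c / 4 \<le> orbit_mean y n')) \<and> n < n'"
      for n k
    proof -
      have "0 < 1 / real (Suc (Suc k))" by simp
      from ex[OF this, of n] obtain n' where "n' > n"
        "\<exists>y\<in>D. fnorm y < 1 / real (Suc (Suc k)) \<and> c / 4 \<le> orbit_mean y n'" by blast
      then show ?thesis
        by (intro exI[of _ n'] conjI) auto
    qed
  qed
  then show ?R
    using c(1) by (intro exI[of _ "c / 4"]) (auto simp: strict_mono_Suc_iff)
next
  assume ?R
  then obtain \<epsilon> and N :: "nat \<Rightarrow> nat" where eN: "\<epsilon> > 0" "strict_mono N" "\<And>k. N k > 0"
    and y: "\<And>k. \<exists>y\<in>D. fnorm y < 1 / real (Suc k) \<and> \<epsilon> \<le> orbit_mean y (N k)" by blast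
  \<comment> \<open>In a triple \<open>(v, n, m)\<close>, \<open>v\<close> is a partial sum,
    \<open>n\<close> a time at which its mean is large, and \<open>m\<close> a time, not before
    \<open>n\<close>, at which the mean is negligible. Largeness is put into \<open>next_to\<close>
    because the construction starts from the zero vector.\<close>
  define good where "good j = (\<lambda>(v, n, m). v \<in> D \<and> j \<le> n \<and> n \<le> m \<and> orbit_mean v m \<le> (1/2) ^ j)"
    for j :: nat
  define next_to where "next_to j = (\<lambda>(v, n :: nat, m) (v', n', m'). m < m' \<and> \<epsilon> / 2 \<le> orbit_mean v' n' \<and>
      (\<forall>i\<le>m. fnorm ((T ^^ i) (v' - v)) \<le> (1/2) ^ j))" for j :: nat
  have "\<exists>f. \<forall>j. good j (f j) \<and> next_to j (f j) (f (Suc j))"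
  proof (rule dependent_nat_choice)
    show "\<exists>t. good 0 t"
      using subspace_0[OF D(1)] by (intro exI[of _ "(0, 0, 0)"]) (simp add: good_def orbit_mean_def)
  next
    fix t j
    assume t: "good j t"
    obtain v n m where t_eq: "t = (v, n, m)" by (cases t)
    have v: "v \<in> D" using t by (simp add: good_def t_eq)
    then have vX: "v \<in> X" using D(2) by blast
    obtain s where s: "(T ^^ s) v = 0" using nilpotent[OF v] ..
    obtain \<delta> where \<delta>: "\<delta> > 0" "\<And>u i. u \<in> X \<Longrightarrow> fnorm u < \<delta> \<Longrightarrow> i \<le> m \<Longrightarrow> fnorm ((T ^^ i) u) < (1/2) ^ j"
      using iter_small[of "(1/2) ^ j" m] by fastforce
    \<comment> \<open>As \<open>N k \<ge> k\<close>, taking \<open>k\<close> large meets three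
      demands: \<open>k0\<close> makes the new summand smaller than \<open>\<delta>\<close>,
      \<open>k1\<close> makes the mean of the old \<open>v\<close> at time \<open>N k\<close> at
      most \<open>\<epsilon> / 2\<close>, and \<open>Suc j\<close> makes that time late
      enough.\<close>
    obtain k0 :: nat where k0: "1 / \<delta> < real k0" using reals_Archimedean2 by blast
    obtain k1 :: nat where k1: "2 * real s / \<epsilon> < real k1" using reals_Archimedean2 by blast
    define k where "k = max (max k0 k1) (Suc j)"
    have "N k \<ge> k" using eN(2) by (rule strict_mono_imp_increasing)
    then have Nk: "N k \<ge> Suc j" "real (N k) > 2 * real s / \<epsilon>" and "real (Suc k) > 1 / \<delta>"
      using k0 k1 unfolding k_def by linarith+
    then have k: "1 / real (Suc k) < \<delta>" "real s / real (N k) \<le> \<epsilon> / 2"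
      using \<delta>(1) eN(1) eN(3)[of k] by (auto simp: field_simps)
    obtain u where u: "u \<in> D" "fnorm u < 1 / real (Suc k)" "\<epsilon> \<le> orbit_mean u (N k)"
      using y by blast
    have uX: "u \<in> X" using u(1) D(2) by blast
    define v' where "v' = v + u"
    have v': "v' \<in> D" using v u(1) D(1) by (simp add: v'_def subspace_add)
    then have v'X: "v' \<in> X" using D(2) by blast
    \<comment> \<open>Writing \<open>u\<close> as \<open>v' + (- v)\<close> transfers the large mean
      of \<open>u\<close> to \<open>v'\<close>, at the cost of the mean of
      \<open>- v\<close>.\<close>
    have neg: "- v \<in> X" "(T ^^ s) (- v) = 0"
      using diff_in_carrier[of 0 v] iter_diff[of 0 v s] s vX by simp_all
    have "orbit_mean u (N k) \<le> orbit_mean v' (N k) + orbit_mean (- v) (N k)"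
      using orbit_mean_triangle[OF v'X neg(1), of "N k"] by (simp add: v'_def)
    also have "orbit_mean (- v) (N k) \<le> \<epsilon> / 2"
      using orbit_mean_nilpotent[OF neg eN(3), of k] k(2) by (rule order_trans)
    finally have mean_v': "\<epsilon> / 2 \<le> orbit_mean v' (N k)" using u(3) by simp
    obtain s' where s': "(T ^^ s') v' = 0" using nilpotent[OF v'] ..
    \<comment> \<open>The mean of \<open>v'\<close> at time \<open>m'\<close> is at most
      \<open>s' / m'\<close>, and \<open>m0\<close> brings this down to
      \<open>(1/2) ^ Suc j\<close>.\<close>
    obtain m0 :: nat where m0: "real s' * 2 ^ Suc j < real m0" using reals_Archimedean2 by blast
    define m' where "m' = max (max (Suc m) (N k)) m0"
    have m': "m < m'" "N k \<le> m'" "real s' * 2 ^ Suc j \<le> real m'"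
      using m0 unfolding m'_def by linarith+
    have "orbit_mean v' m' \<le> real s' / real m'"
      using orbit_mean_nilpotent[OF v'X s'] m'(1) by simp
    also have "\<dots> \<le> (1/2) ^ Suc j"
      using m'(1,3) by (simp add: field_simps power_divide)
    finally have "good (Suc j) (v', N k, m')"
      using v' Nk(1) m' by (simp add: good_def)
    moreover have "next_to j t (v', N k, m')"
      using m'(1) mean_v' \<delta>(2)[OF uX] u(2) k(1) by (auto simp: next_to_def t_eq v'_def intro: less_imp_le)
    ultimately show "\<exists>t'. good (Suc j) t' \<and> next_to j t t'" by blast
  qed
  then obtain f where f: "\<And>j. good j (f j)" "\<And>j. next_to j (f j) (f (Suc j))" by blast
  define v n m where "v j = fst (f j)" and "n j = fst (snd (f j))" and "m j = snd (snd (f j))" for j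
  have good: "v j \<in> D" "j \<le> n j" "n j \<le> m j" "orbit_mean (v j) (m j) \<le> (1/2) ^ j" for j
    using f(1)[of j] by (auto simp: good_def v_def n_def m_def split_beta)
  have nxt: "m j < m (Suc j)" "\<epsilon> / 2 \<le> orbit_mean (v (Suc j)) (n (Suc j))"
    "\<And>i. i \<le> m j \<Longrightarrow> fnorm ((T ^^ i) (v (Suc j) - v j)) \<le> (1/2) ^ j" for j
    using f(2)[of j] by (auto simp: next_to_def v_def n_def m_def split_beta)
  have "\<exists>x. mean_irregular x"
  proof (rule irregular_limit[of v m n "\<epsilon> / 2"])
    show "strict_mono m" using nxt(1) by (simp add: strict_mono_Suc_iff)
  qed (use good nxt eN(1) D(2) in auto)
  then show ?L
    using mean_Li_Yorke_chaotic_iff_irregular by blast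
qed

end

section \<open>Iterates of weighted shifts on finitely supported sequences\<close>

lemma sum_fun_apply: "(\<Sum>j\<in>A. f j) n = (\<Sum>j\<in>A. f j n)"
  by (induction A rule: infinite_finite_induct) auto

lemma sum_canonical_vec_apply:
  "(\<Sum>j<r. seq_scale (b j) (canonical_vec j)) n = (if n < r then b n else (0::'k::real_normed_field))"
proof -
  have "(\<Sum>j<r. seq_scale (b j) (canonical_vec j)) n = (\<Sum>j<r. if n = j then b j else 0)"
    unfolding sum_fun_apply by (rule sum.cong) (auto simp: seq_scale_def canonical_vec_def)
  then show ?thesis by simp
qed

text \<open>Each application moves an entry one place down and multiplies it by the weight of the
  place where it arrives.\<close>

lemma weighted_shift_iter_apply:
  "(weighted_shift w ^^ i) x n = (\<Prod>l\<in>{n..<n + i}. w l) * x (n + i)"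
proof (induction i arbitrary: n)
  case (Suc i)
  have "(weighted_shift w ^^ Suc i) x n = w n * (weighted_shift w ^^ i) x (Suc n)"
    by (simp add: weighted_shift_def[of w "(weighted_shift w ^^ i) x"])
  also have "\<dots> = (w n * (\<Prod>l\<in>{Suc n..<n + Suc i}. w l)) * x (n + Suc i)"
    by (simp add: Suc)
  also have "w n * (\<Prod>l\<in>{Suc n..<n + Suc i}. w l) = (\<Prod>l\<in>{n..<n + Suc i}. w l)"
    by (simp only: prod.atLeast_Suc_lessThan[of n "n + Suc i" w])
  finally show ?case .
qed simp

text \<open>At coordinate \<open>n\<close> only \<open>j = n + i\<close> contributes. The case
  \<open>i > j\<close> encodes the convention that vectors pushed below the first index vanish;
  truncated subtraction alone would leave them at index 0.\<close>

lemma weighted_shift_iter_sum: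
  fixes w b :: "nat \<Rightarrow> 'k::real_normed_field"
  shows "(weighted_shift w ^^ i) (\<Sum>j<r. seq_scale (b j) (canonical_vec j)) =
    (\<Sum>j<r. if i \<le> j then seq_scale (b j * (\<Prod>l\<in>{j-i..<j}. w l)) (canonical_vec (j - i)) else 0)"
    (is "?lhs = ?rhs")
proof
  fix n
  have "?rhs n = (\<Sum>j<r. if j = n + i then b j * (\<Prod>l\<in>{n..<n + i}. w l) else 0)"
    unfolding sum_fun_apply by (rule sum.cong) (auto simp: seq_scale_def canonical_vec_def)
  then show "?lhs n = ?rhs n"
    by (simp add: weighted_shift_iter_apply sum_canonical_vec_apply)
qed

(* A real normed field that is a Euclidean space is the real or the complex field, up to
   isometric isomorphism, so the type variable 'k ranges over exactly these two scalar fields. *)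
theorem theorem32:
  fixes X :: "(nat \<Rightarrow> 'k::{real_normed_field,euclidean_space}) set"
    and p :: "nat \<Rightarrow> (nat \<Rightarrow> 'k) \<Rightarrow> real"
    and w :: "nat \<Rightarrow> 'k"
  assumes "frechet_sequence_space X p"
    and "canonical_basis X p"
    and "\<And>n. w n \<noteq> 0"
    and "weighted_shift w ` X \<subseteq> X"
    and "continuous_map (Metric_space.mtopology X (compatible_metric X p))
           (Metric_space.mtopology X (compatible_metric X p)) (weighted_shift w)"
  shows "Metric_space.mean_Li_Yorke_chaotic X (compatible_metric X p) (weighted_shift w) \<longleftrightarrow>
    (\<exists>\<epsilon>::real. \<epsilon> > 0 \<and> (\<exists>N :: nat \<Rightarrow> nat. strict_mono N \<and> (\<forall>k. N k > 0) \<and>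
      (\<forall>k. \<exists>r>0. \<exists>b :: nat \<Rightarrow> 'k.
         compatible_metric X p (\<Sum>j<r. seq_scale (b j) (canonical_vec j)) 0 < 1 / real (Suc k) \<and>
         1 / real (N k) * (\<Sum>i=1..N k. compatible_metric X p
             (\<Sum>j<r. if i \<le> j
                     then seq_scale (b j * (\<Prod>l\<in>{j-i..<j}. w l)) (canonical_vec (j - i))
                     else 0) 0) \<ge> \<epsilon>)))"
proof -
  interpret frechet_sequence_space X p by fact
  interpret frechet_operator seq_scale X p "weighted_shift w"
    by unfold_locales
      (use assms(5) in \<open>auto simp: weighted_shift_def seq_scale_def algebra_simps\<close>)
  define fin :: "nat \<Rightarrow> (nat \<Rightarrow> 'k) \<Rightarrow> nat \<Rightarrow> 'k"
    where "fin r b = (\<Sum>j<r. seq_scale (b j) (canonical_vec j))" for r b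
  \<comment> \<open>Described by vanishing tails, \<open>D\<close> is visibly a subspace; its
    members are exactly the vectors \<open>fin r b\<close>.\<close>
  define D where "D = {x :: nat \<Rightarrow> 'k. \<exists>r. \<forall>n\<ge>r. x n = 0}"
  have fin_apply: "fin r b n = (if n < r then b n else 0)" for r b n
    unfolding fin_def by (rule sum_canonical_vec_apply)
  have fin_D: "fin r b \<in> D" for r b
    by (auto simp: D_def fin_apply intro!: exI[of _ r])
  have D_fin: "\<exists>r>0. x = fin r x" if x: "x \<in> D" for x
  proof -
    obtain r where "\<forall>n\<ge>r. x n = 0" using x by (auto simp: D_def)
    \<comment> \<open>The sequence \<open>x\<close> serves as its own coefficients, and
      \<open>Suc r\<close> ensures a positive length.\<close>
    then have "x = fin (Suc r) x" by (auto simp: fin_apply fun_eq_iff)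
    then show ?thesis by blast
  qed
  have fin_X: "fin r b \<in> X" for r b
    unfolding fin_def using assms(2)
    by (intro subspace_sum[OF subspace_carrier]) (auto simp: canonical_basis_def)
  have "subspace D"
    unfolding subspace_def
  proof (intro conjI ballI allI)
    fix x y c assume "x \<in> D" "y \<in> D"
    then obtain r s where "\<forall>n\<ge>r. x n = 0" "\<forall>n\<ge>s. y n = 0" by (auto simp: D_def)
    then show "x + y \<in> D" by (auto simp: D_def intro!: exI[of _ "max r s"])
  next
    fix x c assume "x \<in> D"
    then show "seq_scale c x \<in> D" by (auto simp: D_def seq_scale_def)
  qed (simp add: D_def)
  moreover have "D \<subseteq> X" using D_fin fin_X by (metis subsetI)
  moreover have "\<exists>s. (weighted_shift w ^^ s) x = 0" if x: "x \<in> D" for x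
  proof -
    obtain r where "\<forall>n\<ge>r. x n = 0" using x by (auto simp: D_def)
    \<comment> \<open>Coordinate \<open>n\<close> of the iterate of order \<open>r\<close> is a
      multiple of \<open>x (n + r)\<close>, which is 0.\<close>
    then show ?thesis
      by (intro exI[of _ r]) (simp add: weighted_shift_iter_apply fun_eq_iff)
  qed
  moreover have "\<exists>y\<in>D. fnorm (y - x) < e" if "x \<in> X" "e > 0" for x e
  proof -
    \<comment> \<open>Density is the basis property: the partial sums of the expansion of
      \<open>x\<close> are its truncations, and these lie in \<open>D\<close>.\<close>
    have "limitin mtopology (\<lambda>n. fin n x) x sequentially"
      using assms(2) that(1) by (simp add: canonical_basis_def fin_def)
    then obtain n where "compatible_metric X p (fin n x) x < e"
      using \<open>e > 0\<close> by (force simp: limit_metric_sequentially)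
    then show ?thesis
      using fin_D that(1) fin_X by (auto simp: compatible_metric_eq_fnorm)
  qed
  ultimately have "mean_Li_Yorke_chaotic (weighted_shift w) \<longleftrightarrow>
     (\<exists>\<epsilon>>0. \<exists>N::nat \<Rightarrow> nat. strict_mono N \<and> (\<forall>k. N k > 0) \<and>
       (\<forall>k. \<exists>y\<in>D. fnorm y < 1 / real (Suc k) \<and> \<epsilon> \<le> orbit_mean y (N k)))"
    by (rule mean_Li_Yorke_chaotic_criterion)
  moreover have "(\<exists>y\<in>D. P y) \<longleftrightarrow> (\<exists>r>0. \<exists>b. P (fin r b))" for P
    using D_fin fin_D by (metis (no_types))
  ultimately show ?thesis
    by (simp only: orbit_mean_def fnorm_def fin_def weighted_shift_iter_sum)
qed

end
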